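(* Let $K\subset\mathcal{E}$ be a closed convex cone with nonempty interior and $K\ne\mathcal{E}$. Then, for $\lambda\in\mathbb{R}$, $K$ is $\lambda$-smoothable if and only if $\lambda\ge\frac{w_K}{2+w_K}$. In particular, for any target smoothness level $\beta>0$, a $\beta$-smooth closed convex set $S\subseteq\mathcal{E}$ is an optimal $\beta$-smoothing of $K$ if and only if $[s^{\mathrm{gen}}_K]_{1/\beta}\subseteq S\subseteq[S^{\mathrm{gen}}_K]_{1/\beta}$.
   Context: $\mathcal{E}$ is a finite-dimensional Euclidean space with inner product $\langle\cdot,\cdot\rangle$ and induced norm $\|\cdot\|$; $B(x,r)=\{y:\|x-y\|\le r\}$; sums of sets are Minkowski sums; all sets considered are nonempty. A convex cone is a set $K$ with $tx\in K$ for $x\in K$, $t\ge0$, and $x+y\in K$ for $x,y\in K$. For $\eta>0$, $[C]_\eta=\eta C=\{\eta x:x\in C\}$. Hausdorff distance: $\mathrm{dist}(x,C)=\inf_{y\in C}\|x-y\|$, $\mathrm{d}(\tilde C;C)=\sup_{x\in\tilde C}\mathrm{dist}(x,C)$, $\mathrm{dist}(\tilde C,C)=\max\{\mathrm{d}(\tilde C;C),\mathrm{d}(C;\tilde C)\}$ (possibly $+\infty$). Normal cone: $N_C(x)=\{\zeta:\langle\zeta,y-x\rangle\le0\ \forall y\in C\}$ for $x\in C$. A closed convex set $C$ is $\beta$-smooth if $\|\zeta-\zeta'\|\le\beta\|x-x'\|$ for all $x,x'\in C$ and all unit-norm $\zeta\in N_C(x)$, $\zeta'\in N_C(x')$. Smoothability: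 $K$ is $\lambda$-smoothable if for every $\beta>0$ there is a $\beta$-smooth closed convex set $S$ with $\mathrm{dist}(S,K)\le\lambda/\beta$. A closed convex set $S$ is an optimal $\beta$-smoothing of $K$ if $S$ is $\beta$-smooth and $\mathrm{dist}(K,S)\le\mathrm{dist}(K,\tilde S)$ for all $\beta$-smooth closed convex $\tilde S$. Core, center, width: $C_K=\{x\in\mathcal{E}:x+B(0,1)\subseteq K\}$; $x_K$ is the (unique) minimum-norm element of $C_K$; $w_K=\|x_K\|-1$. Extremal smoothings: $s^{\mathrm{gen}}_K=\frac{1}{1+w_K/2}\big[(x_K+K)+B(0,1+\tfrac{w_K}{2})\big]$ and $S^{\mathrm{gen}}_K=\frac{1}{1+w_K/2}\big[C_K+B(0,1+\tfrac{w_K}{2})\big]$. *)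

theory Defs
  imports "HOL-Analysis.Analysis"
begin

text \<open>
  The ambient Euclidean space is a type of class \<^class>\<open>euclidean_space\<close>. The sum \<open>A + B\<close> of two
  sets is the Minkowski sum of theory \<open>Set_Algebras\<close>.
\<close>

text \<open>The distances take values in the extended reals because they can be \<open>\<infinity>\<close>. They are meant for
  nonempty sets only; on empty sets they have no significance.\<close>

definition excess :: "'a::euclidean_space set \<Rightarrow> 'a set \<Rightarrow> ereal" where
  "excess A C = (SUP x\<in>A. ereal (infdist x C))"

definition hausdorff_dist :: "'a::euclidean_space set \<Rightarrow> 'a set \<Rightarrow> ereal" where
  "hausdorff_dist A C = max (excess A C) (excess C A)"

text \<open>Only used for \<open>x \<in> C\<close>.\<close>

definition normal_cone :: "'a::euclidean_space set \<Rightarrow> 'a \<Rightarrow> 'a set" where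
  "normal_cone C x = {\<zeta>. \<forall>y\<in>C. \<zeta> \<bullet> (y - x) \<le> 0}"

text \<open>Smoothness is a property of nonempty closed convex sets, so these conditions are included.\<close>

definition smooth_set :: "real \<Rightarrow> 'a::euclidean_space set \<Rightarrow> bool" where
  "smooth_set \<beta> C \<longleftrightarrow>
     C \<noteq> {} \<and> closed C \<and> convex C \<and>
     (\<forall>x\<in>C. \<forall>x'\<in>C. \<forall>\<zeta>\<in>normal_cone C x. \<forall>\<zeta>'\<in>normal_cone C x'.
        norm \<zeta> = 1 \<longrightarrow> norm \<zeta>' = 1 \<longrightarrow> norm (\<zeta> - \<zeta>') \<le> \<beta> * norm (x - x'))"

definition smoothable :: "real \<Rightarrow> 'a::euclidean_space set \<Rightarrow> bool" where
  "smoothable l K \<longleftrightarrow> (\<forall>\<beta>>0. \<exists>S. smooth_set \<beta> S \<and> hausdorff_dist S K \<le> ereal (l / \<beta>))"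

definition optimal_smoothing :: "real \<Rightarrow> 'a::euclidean_space set \<Rightarrow> 'a set \<Rightarrow> bool" where
  "optimal_smoothing \<beta> K S \<longleftrightarrow>
     smooth_set \<beta> S \<and> (\<forall>T. smooth_set \<beta> T \<longrightarrow> hausdorff_dist K S \<le> hausdorff_dist K T)"

definition scale_set :: "real \<Rightarrow> 'a::euclidean_space set \<Rightarrow> 'a set" where
  "scale_set \<eta> C = (\<lambda>x. \<eta> *\<^sub>R x) ` C"

definition cone_core :: "'a::euclidean_space set \<Rightarrow> 'a set" where
  "cone_core K = {x. {x} + cball 0 1 \<subseteq> K}"

text \<open>The minimum-norm element exists and is unique when \<open>cone_core K\<close> is nonempty, closed and
  convex, which holds for every closed convex cone \<open>K\<close> with nonempty interior.\<close>

definition cone_center :: "'a::euclidean_space set \<Rightarrow> 'a" where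
  "cone_center K = (THE x. x \<in> cone_core K \<and> (\<forall>y\<in>cone_core K. norm x \<le> norm y))"

definition cone_width :: "'a::euclidean_space set \<Rightarrow> real" where
  "cone_width K = norm (cone_center K) - 1"

definition s_gen :: "'a::euclidean_space set \<Rightarrow> 'a set" where
  "s_gen K = scale_set (1 / (1 + cone_width K / 2))
     (({cone_center K} + K) + cball 0 (1 + cone_width K / 2))"

definition S_gen :: "'a::euclidean_space set \<Rightarrow> 'a set" where
  "S_gen K = scale_set (1 / (1 + cone_width K / 2))
     (cone_core K + cball 0 (1 + cone_width K / 2))"

end

theory Submission
  imports Defs
begin

text \<open>
  Write \<open>r = 1 / \<beta>\<close> and \<open>w\<close> for the width of \<open>K\<close>. The argument rests on one geometric fact: a
  \<open>\<beta>\<close>-smooth set is exactly a union of balls of radius \<open>r\<close> whose centers form a closed convex set.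
  That every point of a smooth set lies in such a ball is \<open>smooth_set_ball_cover\<close>; that adding a ball
  to a closed convex set makes it smooth is \<open>smooth_set_plus_cball\<close>.

  Let \<open>S\<close> be \<open>\<beta>\<close>-smooth at Hausdorff distance at most \<open>e < r\<close> from \<open>K\<close>. A ball of radius \<open>r\<close> inside \<open>S\<close>
  lies in the \<open>e\<close>-neighbourhood of \<open>K\<close>, and by convexity the concentric ball of radius \<open>r - e\<close> lies in
  \<open>K\<close>. After rescaling, its center \<open>c\<close> is a point of the core, so \<open>norm c \<ge> (r - e) * (1 + w)\<close>. On the
  other hand the apex of \<open>K\<close> is within \<open>e\<close> of \<open>S\<close>, hence within \<open>r + e\<close> of the center of some such
  ball. Comparing the two bounds gives \<open>e \<ge> r * w / (2 + w)\<close>.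

  In the case of equality, every center is a point of \<open>r - e\<close> times the core, which puts \<open>S\<close>
  inside the maximal smoothing; and the center close to the apex must be the scaled
  minimum-norm point of the core. The set \<open>S\<close> then contains the ball around that point, and since the
  cone \<open>K\<close> stays within bounded distance of \<open>S\<close>, it consists of recession directions of \<open>S\<close>. So \<open>S\<close>
  contains the minimal smoothing. Conversely, for a set between the extremal ones
  (\<open>between_gens_imp_close\<close>), the maximal smoothing controls how far it leaves \<open>K\<close>, and the minimal
  one how far \<open>K\<close> leaves it.
\<close>

section \<open>Normals of a closed convex set\<close>

lemma norm_diff_scaled_unit:
  fixes v \<zeta> :: "'a::real_inner"
  assumes "norm \<zeta> = 1"
  shows "(norm (v - t *\<^sub>R \<zeta>))\<^sup>2 = (norm v)\<^sup>2 + t\<^sup>2 - 2 * t * (\<zeta> \<bullet> v)"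
  using assms dot_norm_neg[of v "t *\<^sub>R \<zeta>"]
  by (simp add: power_mult_distrib inner_commute[of v] field_simps)

lemma normal_coneD: "\<zeta> \<in> normal_cone S x \<Longrightarrow> y \<in> S \<Longrightarrow> \<zeta> \<bullet> (y - x) \<le> 0"
  by (simp add: normal_cone_def)

lemma projection_normal:
  fixes S :: "'a::euclidean_space set"
  assumes "closed S" "convex S" "S \<noteq> {}" "z \<notin> S"
  obtains p \<zeta> t where "p \<in> S" "\<zeta> \<in> normal_cone S p" "norm \<zeta> = 1" "0 < t" "z = p + t *\<^sub>R \<zeta>"
proof -
  define p where "p = closest_point S z"
  have p: "p \<in> S"
    using assms closest_point_in_set p_def by blast
  with \<open>z \<notin> S\<close> have pos: "norm (z - p) > 0"
    by auto
  have "(1 / norm (z - p)) *\<^sub>R (z - p) \<in> normal_cone S p"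
    using closest_point_dot[OF \<open>convex S\<close> \<open>closed S\<close>, of _ z] pos
    by (auto simp: normal_cone_def p_def divide_le_0_iff)
  with p pos show thesis
    by (intro that[of p "(1 / norm (z - p)) *\<^sub>R (z - p)" "norm (z - p)"]) auto
qed

lemma frontier_normal:
  fixes S :: "'a::euclidean_space set"
  assumes "closed S" "convex S" "y \<in> frontier S"
  obtains \<zeta> where "\<zeta> \<in> normal_cone S y" "norm \<zeta> = 1"
proof -
  have y: "y \<in> S" "y \<notin> interior S"
    using assms by (auto simp: frontier_def)
  \<comment> \<open>A set without interior points may have \<open>y\<close> in its relative interior; then a normal of the
    hyperplane that contains \<open>S\<close> serves.\<close>
  obtain a where a: "a \<noteq> 0" "\<And>x. x \<in> S \<Longrightarrow> a \<bullet> (x - y) \<le> 0"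
  proof (cases "interior S = {}")
    case True
    then obtain a b where "a \<noteq> 0" "S \<subseteq> {x. a \<bullet> x = b}"
      using empty_interior_subset_hyperplane[OF \<open>convex S\<close>] by metis
    with y(1) have "a \<bullet> (x - y) \<le> 0" if "x \<in> S" for x
      using that by (simp add: inner_diff_right subset_iff)
    with \<open>a \<noteq> 0\<close> show thesis
      by (rule that)
  next
    case False
    then have "y \<notin> rel_interior S"
      using y rel_interior_nonempty_interior by blast
    then obtain a where "a \<noteq> 0" "\<And>x. x \<in> S \<Longrightarrow> a \<bullet> y \<le> a \<bullet> x"
      using supporting_hyperplane_rel_boundary[OF \<open>convex S\<close> y(1)] by metis
    then show thesis
      using that[of "- a"] by (auto simp: inner_diff_right)
  qed
  then show thesis
    by (intro that[of "(1 / norm a) *\<^sub>R a"]) (auto simp: normal_cone_def divide_le_0_iff)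
qed

text \<open>Projecting back along a normal direction is optimal, because the supporting halfspace already
  keeps the whole of \<open>S\<close> at distance \<open>t\<close>. For \<open>t \<le> 0\<close> the bound is trivial.\<close>

lemma infdist_along_normal:
  fixes S :: "'a::euclidean_space set"
  assumes "p \<in> S" "\<zeta> \<in> normal_cone S p" "norm \<zeta> = 1"
  shows "t \<le> infdist (p + t *\<^sub>R \<zeta>) S"
proof -
  have "t \<le> dist (p + t *\<^sub>R \<zeta>) y" if "y \<in> S" for y
  proof -
    have "t \<le> \<zeta> \<bullet> (p + t *\<^sub>R \<zeta> - y)"
      using normal_coneD[OF assms(2) that] \<open>norm \<zeta> = 1\<close>
      by (simp add: inner_diff_right inner_add_right norm_eq_1)
    also have "\<dots> \<le> norm \<zeta> * norm (p + t *\<^sub>R \<zeta> - y)"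
      by (rule norm_cauchy_schwarz)
    finally show ?thesis
      using \<open>norm \<zeta> = 1\<close> by (simp add: dist_norm)
  qed
  then show ?thesis
    using \<open>p \<in> S\<close> by (auto simp: infdist_def intro!: cINF_greatest)
qed

text \<open>
  The number \<open>d\<close> is the signed distance from \<open>c\<close> to the boundary of \<open>S\<close>: negative exactly outside
  \<open>S\<close>. The negative case matters because in \<open>smooth_set_inner_ball\<close> the point \<open>c\<close> is obtained by
  walking inwards from the boundary, possibly straight through \<open>S\<close>. For \<open>c\<close> in \<open>S\<close> the witness \<open>y\<close> is a nearest
  frontier point; the ball of radius \<open>d\<close> around \<open>c\<close> lies in \<open>S\<close>, so a normal at \<open>y\<close> also supports that
  ball, which forces it to point from \<open>c\<close> to \<open>y\<close>.
\<close>

lemma ball_exits_along_normal: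
  fixes S :: "'a::euclidean_space set"
  assumes "closed S" "convex S" "S \<noteq> {}" "0 < r" "\<not> cball c r \<subseteq> S"
  obtains y \<zeta> d where "y \<in> S" "\<zeta> \<in> normal_cone S y" "norm \<zeta> = 1" "d < r" "y = c + d *\<^sub>R \<zeta>"
proof (cases "c \<in> S")
  case False
  then obtain p \<zeta> t where "p \<in> S" "\<zeta> \<in> normal_cone S p" "norm \<zeta> = 1" "0 < t" "c = p + t *\<^sub>R \<zeta>"
    using projection_normal assms by metis
  with \<open>0 < r\<close> show thesis
    by (intro that[of p \<zeta> "- t"]) auto
next
  case True
  have sub: "frontier S \<subseteq> S"
    using \<open>closed S\<close> frontier_subset_eq by blast
  have crossing: "\<exists>y\<in>frontier S. norm (y - c) < norm (q - c)" if "q \<notin> S" for q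
  proof -
    have "c \<in> closed_segment c q \<inter> S" "q \<in> closed_segment c q - S"
      using True that by auto
    then have "closed_segment c q \<inter> frontier S \<noteq> {}"
      by (intro connected_Int_frontier connected_segment) blast+
    then obtain y where y: "y \<in> closed_segment c q" "y \<in> frontier S"
      by blast
    then obtain u where u: "0 \<le> u" "u \<le> 1" "y = (1 - u) *\<^sub>R c + u *\<^sub>R q"
      by (auto simp: in_segment)
    have "y \<noteq> q"
      using y(2) sub that by auto
    with u have "u < 1"
      by (cases "u = 1") auto
    have "y - c = u *\<^sub>R (q - c)"
      using u(3) by (simp add: algebra_simps)
    then have "norm (y - c) = u * norm (q - c)"
      using u(1) by simp
    moreover have "0 < norm (q - c)"
      using True that by auto
    ultimately show ?thesis
      using y(2) \<open>u < 1\<close> by (intro bexI[of _ y]) auto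
  qed
  obtain q where q: "q \<notin> S" "norm (q - c) \<le> r"
    using assms(5) by (auto simp: subset_iff dist_norm norm_minus_commute[of c])
  obtain y where y: "y \<in> frontier S" "\<And>z. z \<in> frontier S \<Longrightarrow> dist c y \<le> dist c z"
    using distance_attains_inf[of "frontier S" c] crossing[OF q(1)] by (metis empty_iff frontier_closed)
  define d where "d = norm (y - c)"
  have least: "d \<le> norm (z - c)" if "z \<in> frontier S" for z
    using y(2)[OF that] by (simp add: d_def dist_norm norm_minus_commute)
  have "d < r"
    using crossing[OF q(1)] q(2) least by fastforce
  have ball: "z \<in> S" if "norm (z - c) \<le> d" for z
    using crossing[of z] least that by fastforce
  obtain \<zeta> where \<zeta>: "\<zeta> \<in> normal_cone S y" "norm \<zeta> = 1"
    using frontier_normal assms y by metis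
  \<comment> \<open>The extreme point of the inscribed ball in direction \<open>\<zeta>\<close> cannot pass the hyperplane through \<open>y\<close>.\<close>
  have "c + d *\<^sub>R \<zeta> \<in> S"
    using \<zeta> by (intro ball) (auto simp: d_def)
  then have "d \<le> \<zeta> \<bullet> (y - c)"
    using normal_coneD[OF \<zeta>(1)] \<zeta>(2) by (force simp: algebra_simps norm_eq_1)
  have "(norm (y - c - d *\<^sub>R \<zeta>))\<^sup>2 = (norm (y - c))\<^sup>2 + d\<^sup>2 - 2 * d * (\<zeta> \<bullet> (y - c))"
    by (rule norm_diff_scaled_unit[OF \<zeta>(2)])
  moreover have "d * d \<le> d * (\<zeta> \<bullet> (y - c))"
    using \<open>d \<le> \<zeta> \<bullet> (y - c)\<close> by (intro mult_left_mono) (simp_all add: d_def)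
  ultimately have "(norm (y - c - d *\<^sub>R \<zeta>))\<^sup>2 \<le> 0"
    unfolding d_def[symmetric] power2_eq_square[of d] by linarith
  then have "y - c - d *\<^sub>R \<zeta> = 0"
    by simp
  then have "y = c + d *\<^sub>R \<zeta>"
    by (metis add.commute diff_diff_eq eq_iff_diff_eq_0)
  with \<zeta> \<open>d < r\<close> y sub show thesis
    by (intro that[of y \<zeta> d]) auto
qed

section \<open>Smooth sets as unions of balls\<close>

text \<open>
  If the ball were to leave \<open>S\<close>, its center would be at signed distance \<open>d < r\<close> from some boundary point
  \<open>y\<close> with normal \<open>\<eta>\<close>. Put \<open>q = (norm (\<zeta> - \<eta>))\<^sup>2\<close>. Smoothness, expanded with \<open>x - y = r \<zeta> - d \<eta>\<close>, says
  \<open>r * q \<le> r - d\<close>, whereas convexity of \<open>S\<close>, in the form that \<open>x\<close> is in the halfspace at \<open>y\<close>, says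
  \<open>r * q \<ge> 2 * (r - d)\<close>. This replaces the usual detour through cocoercivity of Lipschitz monotone
  maps.
\<close>

lemma smooth_set_inner_ball:
  fixes S :: "'a::euclidean_space set"
  assumes S: "smooth_set \<beta> S" and "0 < \<beta>" and r: "r = 1 / \<beta>"
    and x: "x \<in> S" "\<zeta> \<in> normal_cone S x" "norm \<zeta> = 1"
  shows "cball (x - r *\<^sub>R \<zeta>) r \<subseteq> S"
proof (rule ccontr)
  assume exits: "\<not> ?thesis"
  have "0 < r"
    using \<open>0 < \<beta>\<close> r by simp
  have "closed S" "convex S" "S \<noteq> {}"
    using S by (auto simp: smooth_set_def)
  then obtain y \<eta> d where y: "y \<in> S" "\<eta> \<in> normal_cone S y" "norm \<eta> = 1" "d < r"
      "y = (x - r *\<^sub>R \<zeta>) + d *\<^sub>R \<eta>"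
    using ball_exits_along_normal[OF _ _ _ \<open>0 < r\<close> exits] by metis
  define a where "a = \<zeta> \<bullet> \<eta>"
  have xy: "x - y = r *\<^sub>R \<zeta> - d *\<^sub>R \<eta>"
    using y(5) by simp
  have "norm (\<zeta> - \<eta>) \<le> \<beta> * norm (x - y)"
    using S x y unfolding smooth_set_def by blast
  then have "r * norm (\<zeta> - \<eta>) \<le> r * (\<beta> * norm (x - y))"
    using \<open>0 < r\<close> by (intro mult_left_mono) auto
  then have "r * norm (\<zeta> - \<eta>) \<le> norm (x - y)"
    using \<open>0 < \<beta>\<close> r by simp
  then have "(r * norm (\<zeta> - \<eta>))\<^sup>2 \<le> (norm (x - y))\<^sup>2"
    using \<open>0 < r\<close> by (intro power_mono) auto
  moreover have "(norm (\<zeta> - \<eta>))\<^sup>2 = 2 - 2 * a"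
    using x(3) y(3) by (simp add: power2_norm_eq_inner a_def inner_diff inner_commute norm_eq_1)
  moreover have "(norm (x - y))\<^sup>2 = r\<^sup>2 + d\<^sup>2 - 2 * r * d * a"
    unfolding xy using x(3) y(3)
    by (simp add: power2_norm_eq_inner a_def inner_diff inner_commute norm_eq_1
        power2_eq_square[of r] power2_eq_square[of d])
  ultimately have "r\<^sup>2 * (2 - 2 * a) \<le> r\<^sup>2 + d\<^sup>2 - 2 * r * d * a"
    by (simp add: power_mult_distrib)
  then have "(r - d) * (r * (2 - 2 * a)) \<le> (r - d) * (r - d)"
    by (simp add: algebra_simps power2_eq_square)
  then have "r * (2 - 2 * a) \<le> r - d"
    using \<open>d < r\<close> by simp
  moreover have "r * a \<le> d"
    using normal_coneD[OF y(2) x(1)] y(3) unfolding xy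
    by (simp add: a_def inner_diff inner_commute norm_eq_1)
  ultimately show False
    using \<open>d < r\<close> by (simp add: algebra_simps)
qed

text \<open>Either the ball around \<open>s\<close> itself fits, or \<open>s\<close> lies at depth \<open>d < r\<close> on the inward normal line of
  some boundary point, and then the inner ball touching there reaches \<open>s\<close>.\<close>

lemma smooth_set_ball_cover:
  fixes S :: "'a::euclidean_space set"
  assumes S: "smooth_set \<beta> S" and "0 < \<beta>" and r: "r = 1 / \<beta>" and "s \<in> S"
  obtains c where "cball c r \<subseteq> S" "norm (s - c) \<le> r"
proof (cases "cball s r \<subseteq> S")
  case True
  with \<open>0 < \<beta>\<close> r show thesis
    by (intro that[of s]) auto
next
  case False
  have "closed S" "convex S" "S \<noteq> {}" "0 < r"
    using S \<open>0 < \<beta>\<close> r by (auto simp: smooth_set_def)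
  then obtain y \<zeta> d where y: "y \<in> S" "\<zeta> \<in> normal_cone S y" "norm \<zeta> = 1" "d < r"
      "y = s + d *\<^sub>R \<zeta>"
    using ball_exits_along_normal False by metis
  have "0 \<le> d"
    using normal_coneD[OF y(2) \<open>s \<in> S\<close>] y(3,5) by (simp add: norm_eq_1)
  have "s - (y - r *\<^sub>R \<zeta>) = (r - d) *\<^sub>R \<zeta>"
    using y(5) by (simp add: algebra_simps)
  then have "norm (s - (y - r *\<^sub>R \<zeta>)) \<le> r"
    using y(3,4) \<open>0 \<le> d\<close> by simp
  with smooth_set_inner_ball[OF S \<open>0 < \<beta>\<close> r y(1-3)] show thesis
    using that by blast
qed

text \<open>A point with unit normal \<open>\<zeta>\<close> in the sum is \<open>c + r \<zeta>\<close> with \<open>\<zeta>\<close> normal to \<open>C\<close> at \<open>c\<close>. Monotonicity of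
  the normal cone of \<open>C\<close> then makes the map from points to normals \<open>1 / r\<close>-Lipschitz.\<close>

lemma smooth_set_plus_cball:
  fixes C :: "'a::euclidean_space set"
  assumes "closed C" "convex C" "C \<noteq> {}" "0 < \<beta>" and r: "r = 1 / \<beta>"
  shows "smooth_set \<beta> (C + cball 0 r)"
proof -
  have "0 < r"
    using \<open>0 < \<beta>\<close> r by simp
  have touch: "x - r *\<^sub>R \<zeta> \<in> C \<and> \<zeta> \<in> normal_cone C (x - r *\<^sub>R \<zeta>)"
    if x: "x \<in> C + cball 0 r" "\<zeta> \<in> normal_cone (C + cball 0 r) x" "norm \<zeta> = 1" for x \<zeta>
  proof -
    obtain c b where cb: "x = c + b" "c \<in> C" "norm b \<le> r"
      using x(1) by (auto elim!: set_plus_elim)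
    have inC: "c' + r *\<^sub>R \<zeta> \<in> C + cball 0 r" if "c' \<in> C" for c'
      using that x(3) \<open>0 < r\<close> by (intro set_plus_intro) auto
    have "r \<le> \<zeta> \<bullet> b"
      using normal_coneD[OF x(2) inC[OF cb(2)]] x(3) cb(1)
      by (simp add: inner_diff inner_add norm_eq_1)
    have "(norm (b - r *\<^sub>R \<zeta>))\<^sup>2 = (norm b)\<^sup>2 + r\<^sup>2 - 2 * r * (\<zeta> \<bullet> b)"
      by (simp add: norm_diff_scaled_unit x(3))
    also have "\<dots> \<le> r\<^sup>2 + r\<^sup>2 - 2 * r * r"
      using \<open>r \<le> \<zeta> \<bullet> b\<close> \<open>0 < r\<close> cb(3)
      by (intro diff_mono add_mono mult_left_mono power_mono) auto
    also have "\<dots> = 0"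
      by (simp add: power2_eq_square)
    finally have "b = r *\<^sub>R \<zeta>"
      by simp
    with cb have c: "x - r *\<^sub>R \<zeta> = c"
      by simp
    have "\<zeta> \<bullet> (c' - c) \<le> 0" if "c' \<in> C" for c'
      using normal_coneD[OF x(2) inC[OF that]] c by (simp add: algebra_simps)
    with c cb show ?thesis
      by (simp add: normal_cone_def)
  qed
  have "norm (\<zeta> - \<zeta>') \<le> \<beta> * norm (x - x')"
    if x: "x \<in> C + cball 0 r" "\<zeta> \<in> normal_cone (C + cball 0 r) x" "norm \<zeta> = 1"
      and x': "x' \<in> C + cball 0 r" "\<zeta>' \<in> normal_cone (C + cball 0 r) x'" "norm \<zeta>' = 1"
    for x x' \<zeta> \<zeta>'
  proof -
    have "\<zeta> \<bullet> ((x' - r *\<^sub>R \<zeta>') - (x - r *\<^sub>R \<zeta>)) \<le> 0" "\<zeta>' \<bullet> ((x - r *\<^sub>R \<zeta>) - (x' - r *\<^sub>R \<zeta>')) \<le> 0"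
      using touch[OF x] touch[OF x'] normal_coneD by blast+
    then have "r * ((\<zeta> - \<zeta>') \<bullet> (\<zeta> - \<zeta>')) \<le> (\<zeta> - \<zeta>') \<bullet> (x - x')"
      by (simp add: inner_diff inner_commute algebra_simps)
    also have "\<dots> \<le> norm (\<zeta> - \<zeta>') * norm (x - x')"
      by (rule norm_cauchy_schwarz)
    finally have "norm (\<zeta> - \<zeta>') * (r * norm (\<zeta> - \<zeta>')) \<le> norm (\<zeta> - \<zeta>') * norm (x - x')"
      by (simp add: power2_norm_eq_inner[symmetric] power2_eq_square mult_ac)
    then have "r * norm (\<zeta> - \<zeta>') \<le> norm (x - x')"
      by (cases "\<zeta> = \<zeta>'") auto
    then have "\<beta> * (r * norm (\<zeta> - \<zeta>')) \<le> \<beta> * norm (x - x')"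
      using \<open>0 < \<beta>\<close> by (intro mult_left_mono) auto
    then show ?thesis
      using \<open>0 < \<beta>\<close> r by simp
  qed
  moreover have "C + cball 0 r \<noteq> {}"
    using \<open>C \<noteq> {}\<close> \<open>0 < r\<close> set_plus_intro[of _ C 0 "cball 0 r"] by fastforce
  moreover have "closed (C + cball 0 r)"
  proof -
    have "C + cball 0 r = (\<Union>x\<in>C. \<Union>y\<in>cball 0 r. {x + y})"
      by (auto simp: set_plus_def)
    then show ?thesis
      using closed_compact_sums[OF \<open>closed C\<close> compact_cball[of 0 r]] by metis
  qed
  ultimately show ?thesis
    using \<open>convex C\<close> by (simp add: smooth_set_def convex_set_plus)
qed

section \<open>Consequences of a bounded Hausdorff distance\<close>

lemma hausdorff_dist_le_iff:
  "hausdorff_dist A C \<le> ereal e \<longleftrightarrow> (\<forall>x\<in>A. infdist x C \<le> e) \<and> (\<forall>x\<in>C. infdist x A \<le> e)"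
  by (simp add: hausdorff_dist_def excess_def SUP_le_iff)

lemma hausdorff_dist_commute: "hausdorff_dist A C = hausdorff_dist C A"
  by (simp add: hausdorff_dist_def max.commute)

text \<open>Cancellation of balls: were a point of the smaller ball outside \<open>K\<close>, moving it by \<open>e\<close> away from its
  projection would stay in the larger ball and get farther than \<open>e\<close> from \<open>K\<close>.\<close>

lemma cball_shrinks_into_convex:
  fixes K :: "'a::euclidean_space set"
  assumes "closed K" "convex K" "K \<noteq> {}" "0 \<le> e"
    and near: "\<And>z. z \<in> cball c r \<Longrightarrow> infdist z K \<le> e"
  shows "cball c (r - e) \<subseteq> K"
proof (rule subsetI, rule ccontr)
  fix z assume z: "z \<in> cball c (r - e)" "z \<notin> K"
  obtain p \<zeta> t where p: "p \<in> K" "\<zeta> \<in> normal_cone K p" "norm \<zeta> = 1" "0 < t" "z = p + t *\<^sub>R \<zeta>"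
    using projection_normal assms z(2) by metis
  have "norm ((c - z) - e *\<^sub>R \<zeta>) \<le> r"
    using norm_triangle_ineq4[of "c - z" "e *\<^sub>R \<zeta>"] z(1) p(3) \<open>0 \<le> e\<close> by (simp add: dist_norm)
  then have "z + e *\<^sub>R \<zeta> \<in> cball c r"
    by (simp add: dist_norm algebra_simps)
  then have "infdist (p + (t + e) *\<^sub>R \<zeta>) K \<le> e"
    using near p(5) by (simp add: algebra_simps)
  with infdist_along_normal[OF p(1-3), of "t + e"] \<open>0 < t\<close> show False
    by simp
qed

text \<open>A hyperplane separating \<open>s + k\<close> from \<open>S\<close> would bound \<open>S\<close> in a direction in which the ray through \<open>k\<close>
  is unbounded, and the ray would leave every neighbourhood of \<open>S\<close>.\<close>

lemma nearby_cone_recession: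
  fixes S :: "'a::euclidean_space set"
  assumes S: "closed S" "convex S" and "convex_cone K"
    and near: "\<And>k. k \<in> K \<Longrightarrow> infdist k S \<le> e" and "s \<in> S" "k \<in> K"
  shows "s + k \<in> S"
proof (rule ccontr)
  assume "s + k \<notin> S"
  have "S \<noteq> {}"
    using \<open>s \<in> S\<close> by auto
  obtain p \<zeta> t where p: "p \<in> S" "\<zeta> \<in> normal_cone S p" "norm \<zeta> = 1" "0 < t" "s + k = p + t *\<^sub>R \<zeta>"
    using projection_normal[OF S \<open>S \<noteq> {}\<close> \<open>s + k \<notin> S\<close>] by metis
  have "\<zeta> \<bullet> (s + k) = \<zeta> \<bullet> p + t"
    using p(3,5) by (simp add: inner_add norm_eq_1)
  with normal_coneD[OF p(2) \<open>s \<in> S\<close>] \<open>0 < t\<close> have pos: "0 < \<zeta> \<bullet> k"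
    by (simp add: inner_diff inner_add)
  have bound: "real n * (\<zeta> \<bullet> k) \<le> \<zeta> \<bullet> p + e" for n
  proof -
    have "real n *\<^sub>R k \<in> K"
      using \<open>convex_cone K\<close> \<open>k \<in> K\<close> by (simp add: convex_cone_scaleR)
    then obtain y where y: "y \<in> S" "dist (real n *\<^sub>R k) y \<le> e"
      using near infdist_attains_inf[OF S(1) \<open>S \<noteq> {}\<close>] by metis
    have "real n * (\<zeta> \<bullet> k) - \<zeta> \<bullet> y \<le> norm (real n *\<^sub>R k - y)"
      using norm_cauchy_schwarz[of \<zeta> "real n *\<^sub>R k - y"] p(3) by (simp add: inner_diff)
    with y(2) normal_coneD[OF p(2) y(1)] show ?thesis
      by (simp add: dist_norm inner_diff)
  qed
  obtain n where "\<zeta> \<bullet> p + e < real n * (\<zeta> \<bullet> k)"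
    using reals_Archimedean3[OF pos] by metis
  with bound[of n] show False
    by simp
qed

section \<open>The core of a proper solid cone\<close>

lemma scale_set_scale_set: "scale_set a (scale_set b C) = scale_set (a * b) C"
  unfolding scale_set_def image_image by simp

lemma scale_set_plus_cball:
  fixes C :: "'a::euclidean_space set"
  assumes "0 < a"
  shows "scale_set a (C + cball 0 b) = scale_set a C + cball 0 (a * b)"
proof -
  have "scale_set a (C + D) = scale_set a C + scale_set a D" for D
  proof (intro equalityI subsetI)
    fix y assume "y \<in> scale_set a (C + D)"
    then obtain c d where "c \<in> C" "d \<in> D" "y = a *\<^sub>R c + a *\<^sub>R d"
      unfolding scale_set_def by (auto simp: scaleR_add_right elim: set_plus_elim)
    then show "y \<in> scale_set a C + scale_set a D"
      unfolding scale_set_def by blast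
  next
    fix y assume "y \<in> scale_set a C + scale_set a D"
    then obtain c d where "c \<in> C" "d \<in> D" "y = a *\<^sub>R (c + d)"
      unfolding scale_set_def by (auto simp: scaleR_add_right elim: set_plus_elim)
    then show "y \<in> scale_set a (C + D)"
      unfolding scale_set_def by blast
  qed
  moreover have "scale_set a (cball (0::'a) b) = cball 0 (a * b)"
    using cball_scale[of a 0 b] assms by (simp add: scale_set_def)
  ultimately show ?thesis
    by simp
qed

lemma mem_plus_cball: "y \<in> C + cball 0 r \<longleftrightarrow> (\<exists>c\<in>C. norm (y - c) \<le> r)"
proof
  assume "\<exists>c\<in>C. norm (y - c) \<le> r"
  then obtain c where "c \<in> C" "norm (y - c) \<le> r"
    by blast
  then have "c + (y - c) \<in> C + cball 0 r"
    by (intro set_plus_intro) auto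
  then show "y \<in> C + cball 0 r"
    by simp
next
  assume "y \<in> C + cball 0 r"
  then obtain c b where "c \<in> C" "norm b \<le> r" "y = c + b"
    by (auto elim: set_plus_elim)
  then show "\<exists>c\<in>C. norm (y - c) \<le> r"
    by (intro bexI[of _ c]) auto
qed

lemma cone_core_eq: "cone_core K = {x. cball x 1 \<subseteq> K}"
proof -
  have "{x} + cball 0 1 = cball x 1" for x :: 'a
    by (simp add: set_eq_iff mem_plus_cball dist_norm norm_minus_commute)
  then show ?thesis
    by (simp add: cone_core_def)
qed

lemma cball_subset_scale_cone:
  fixes K :: "'a::euclidean_space set"
  assumes "convex_cone K" "0 < t"
  shows "cball (t *\<^sub>R x) t \<subseteq> K \<longleftrightarrow> cball x 1 \<subseteq> K"
proof -
  have *: "cball (a *\<^sub>R z) (a * b) \<subseteq> K" if "0 < a" "cball z b \<subseteq> K" for a b z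
  proof -
    have "(\<lambda>x. a *\<^sub>R x) ` cball z b \<subseteq> K"
      using that \<open>convex_cone K\<close> by (auto intro!: convex_cone_scaleR)
    then show ?thesis
      using cball_scale[of a z b] that by simp
  qed
  show ?thesis
    using *[of t x 1] *[of "1 / t" "t *\<^sub>R x" t] \<open>0 < t\<close> by auto
qed

text \<open>Properness is what places the apex on the boundary of \<open>K\<close> and thereby makes the width
  nonnegative.\<close>

locale proper_solid_cone =
  fixes K :: "'a::euclidean_space set"
  assumes closed: "closed K" and cone: "convex_cone K"
    and solid: "interior K \<noteq> {}" and proper: "K \<noteq> UNIV"
begin

abbreviation "core \<equiv> cone_core K"
abbreviation "center \<equiv> cone_center K"
abbreviation "width \<equiv> cone_width K"

text \<open>The least possible distance between \<open>K\<close> and a \<open>1\<close>-smooth set. The factor \<open>1 / (1 + w / 2)\<close> in the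
  extremal smoothings is \<open>1 - gap\<close>.\<close>

definition gap :: real where "gap = width / (2 + width)"

lemma convex: "convex K" and nonempty: "K \<noteq> {}"
  using cone unfolding convex_cone_def by blast+

lemma closed_core: "closed core" and convex_core: "convex core"
proof -
  have mem_core: "x \<in> core \<longleftrightarrow> (\<forall>b\<in>cball 0 1. x + b \<in> K)" for x
  proof -
    have "{x} + cball 0 1 = (\<lambda>b. x + b) ` cball 0 1"
      unfolding set_plus_def image_def by simp
    then show ?thesis
      by (simp only: cone_core_def mem_Collect_eq image_subset_iff)
  qed
  have mem_translate: "x + b \<in> K \<longleftrightarrow> x \<in> (\<lambda>z. z - b) ` K" for x b
    by (auto intro: image_eqI[of x _ "x + b"])
  have eq: "core = (\<Inter>b\<in>cball 0 1. (\<lambda>z. z - b) ` K)"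
    by (rule set_eqI) (simp only: INT_iff mem_core mem_translate)
  show "closed core"
    unfolding eq using closed by (intro closed_INT ballI closed_translation_subtract)
  show "convex core"
    unfolding eq using convex by (intro convex_INT convex_translation_subtract)
qed

lemma core_nonempty: "core \<noteq> {}"
proof -
  obtain x e where e: "0 < e" "cball x e \<subseteq> K"
    using solid by (auto simp: mem_interior_cball)
  have "cball ((1 / e) *\<^sub>R x) 1 \<subseteq> K"
    using e cball_subset_scale_cone[OF cone e(1), of "(1 / e) *\<^sub>R x"] by simp
  then show ?thesis
    by (auto simp: cone_core_eq)
qed

lemma center_eq: "center = closest_point core 0"
proof -
  let ?p = "closest_point core 0"
  have "?p \<in> core" "\<forall>y\<in>core. norm ?p \<le> norm y"
    using closest_point_exists[OF closed_core core_nonempty, of 0] by simp_all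
  moreover have "x = ?p" if "x \<in> core \<and> (\<forall>y\<in>core. norm x \<le> norm y)" for x
    using closest_point_unique[OF convex_core closed_core, of x 0] that by simp
  ultimately show ?thesis
    unfolding cone_center_def by (intro the_equality conjI)
qed

lemma center_in_core: "center \<in> core"
  using closest_point_in_set[OF closed_core core_nonempty] by (simp add: center_eq)

lemma norm_center: "norm center = 1 + width"
  by (simp add: cone_width_def)

lemma core_norm_ge: "x \<in> core \<Longrightarrow> 1 + width \<le> norm x"
  using closest_point_le[OF closed_core, of x 0] by (simp flip: center_eq add: norm_center)

lemma core_norm_unique:
  assumes "x \<in> core" "norm x \<le> 1 + width"
  shows "x = center"
proof (rule ccontr)
  assume "x \<noteq> center"
  then have "norm center < norm x"
    using closest_point_lt[OF convex_core closed_core \<open>x \<in> core\<close>, of 0]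
    by (simp flip: center_eq)
  with assms(2) show False
    by (simp add: norm_center)
qed

lemma width_nonneg: "0 \<le> width"
proof (rule ccontr)
  assume "\<not> 0 \<le> width"
  then have "0 \<in> ball center 1"
    by (simp add: norm_center)
  moreover have "ball center 1 \<subseteq> K"
    using center_in_core ball_subset_cball[of center 1] unfolding cone_core_eq by blast
  ultimately have "0 \<in> interior K"
    using interior_maximal[OF _ open_ball] by blast
  then obtain e where e: "0 < e" "cball 0 e \<subseteq> K"
    unfolding mem_interior_cball by blast
  have "x \<in> K" for x
  proof (cases "x = 0")
    case False
    have "(e / norm x) *\<^sub>R x \<in> K"
      using e False by (intro subsetD[OF e(2)]) auto
    then have "(norm x / e) *\<^sub>R ((e / norm x) *\<^sub>R x) \<in> K"
      using e(1) by (intro convex_cone_scaleR[OF cone, of "norm x / e"]) simp_all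
    moreover have "(norm x / e) *\<^sub>R ((e / norm x) *\<^sub>R x) = x"
      using e(1) False by simp
    ultimately show ?thesis
      by simp
  qed (use cone convex_cone_contains_0 in auto)
  with proper show False
    by auto
qed

lemma gap_nonneg: "0 \<le> gap" and gap_less_1: "gap < 1"
  and gap_width: "(1 - gap) * (1 + width) = 1 + gap"
  and gap_radius: "1 / (1 + width / 2) = 1 - gap" "(1 - gap) * (1 + width / 2) = 1"
proof -
  have pos: "0 < 2 + width"
    using width_nonneg by simp
  then have width: "gap * (2 + width) = width"
    by (simp add: gap_def)
  show "0 \<le> gap" "gap < 1"
    using pos width_nonneg by (simp_all add: gap_def)
  show "(1 - gap) * (1 + width) = 1 + gap" "(1 - gap) * (1 + width / 2) = 1"
    using width by (simp_all add: algebra_simps)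
  then show "1 / (1 + width / 2) = 1 - gap"
    using pos by (simp add: divide_eq_eq)
qed

text \<open>Homogeneity turns the minimality of the center into a statement on balls of any radius in \<open>K\<close>.\<close>

lemma inner_ball_norm_ge:
  assumes "0 < t" "cball c t \<subseteq> K"
  shows "t * (1 + width) \<le> norm c"
    and "norm c \<le> t * (1 + width) \<Longrightarrow> c = t *\<^sub>R center"
proof -
  have core: "(1 / t) *\<^sub>R c \<in> core"
    using assms cball_subset_scale_cone[OF cone assms(1), of "(1 / t) *\<^sub>R c"]
    by (simp add: cone_core_eq)
  show "t * (1 + width) \<le> norm c"
    using core_norm_ge[OF core] assms(1) by (simp add: pos_le_divide_eq mult.commute)
  show "c = t *\<^sub>R center" if "norm c \<le> t * (1 + width)"
  proof -
    have "(1 / t) *\<^sub>R c = center"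
      using core_norm_unique[OF core] assms(1) that by (simp add: pos_divide_le_eq mult.commute)
    then have "t *\<^sub>R ((1 / t) *\<^sub>R c) = t *\<^sub>R center"
      by simp
    then show ?thesis
      using assms(1) by simp
  qed
qed

lemma scaled_core:
  assumes "0 < t"
  shows "scale_set t core = {c. cball c t \<subseteq> K}"
proof -
  have "c \<in> scale_set t core \<longleftrightarrow> (1 / t) *\<^sub>R c \<in> core" for c
    using assms by (force simp: scale_set_def)
  then show ?thesis
    using cball_subset_scale_cone[OF cone assms, of "(1 / t) *\<^sub>R _"] assms
    by (simp add: set_eq_iff cone_core_eq)
qed

section \<open>Optimal smoothings\<close>

text \<open>In the normalization used here both extremal smoothings are sums with a ball of radius exactly
  \<open>r\<close>; the remaining summands are the centers of balls of radius \<open>r * (1 - gap)\<close> in \<open>K\<close>, and the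
  translate of \<open>K\<close> by the minimal such center.\<close>

lemma scaled_S_gen:
  assumes "0 < r"
  shows "scale_set r (S_gen K) = {c. cball c (r * (1 - gap)) \<subseteq> K} + cball 0 r"
proof -
  have "0 < r * (1 - gap)"
    using assms gap_less_1 by simp
  then have "scale_set r (S_gen K) =
      scale_set (r * (1 - gap)) core + cball 0 (r * (1 - gap) * (1 + width / 2))"
    unfolding S_gen_def gap_radius(1) scale_set_scale_set by (rule scale_set_plus_cball)
  also have "r * (1 - gap) * (1 + width / 2) = r"
    by (simp add: mult.assoc gap_radius(2))
  finally show ?thesis
    by (simp only: scaled_core[OF \<open>0 < r * (1 - gap)\<close>])
qed

lemma scaled_s_gen:
  assumes "0 < r"
  shows "scale_set r (s_gen K) = ({(r * (1 - gap)) *\<^sub>R center} + K) + cball 0 r"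
proof -
  define t where "t = r * (1 - gap)"
  have "0 < t"
    using assms gap_less_1 by (simp add: t_def)
  have "scale_set t ({center} + K) = {t *\<^sub>R center} + K"
  proof (rule set_eqI)
    fix y
    show "y \<in> scale_set t ({center} + K) \<longleftrightarrow> y \<in> {t *\<^sub>R center} + K"
    proof
      assume "y \<in> scale_set t ({center} + K)"
      then obtain k where "k \<in> K" "y = t *\<^sub>R center + t *\<^sub>R k"
        by (auto simp: scale_set_def scaleR_add_right elim!: set_plus_elim)
      then show "y \<in> {t *\<^sub>R center} + K"
        using convex_cone_scaleR[OF cone, of t k] \<open>0 < t\<close> by (auto intro!: set_plus_intro)
    next
      assume "y \<in> {t *\<^sub>R center} + K"
      then obtain k where k: "k \<in> K" "y = t *\<^sub>R center + k"
        by (auto elim!: set_plus_elim)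
      then have "y = t *\<^sub>R (center + (1 / t) *\<^sub>R k)" "(1 / t) *\<^sub>R k \<in> K"
        using convex_cone_scaleR[OF cone, of "1 / t" k] \<open>0 < t\<close> by (auto simp: scaleR_add_right)
      then show "y \<in> scale_set t ({center} + K)"
        unfolding scale_set_def by (auto intro!: set_plus_intro)
    qed
  qed
  moreover have "scale_set r (s_gen K) =
      scale_set t ({center} + K) + cball 0 (t * (1 + width / 2))"
    unfolding s_gen_def gap_radius(1) scale_set_scale_set t_def[symmetric]
    using \<open>0 < t\<close> by (rule scale_set_plus_cball)
  moreover have "t * (1 + width / 2) = r"
    by (simp add: t_def mult.assoc gap_radius(2))
  ultimately show ?thesis
    unfolding t_def by simp
qed

lemma smooth_S_gen:
  assumes "0 < \<beta>"
  shows "smooth_set \<beta> (scale_set (1 / \<beta>) (S_gen K))"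
proof -
  define t where "t = 1 / \<beta> * (1 - gap)"
  have "0 < t"
    using assms gap_less_1 by (simp add: t_def)
  then have eq: "{c. cball c t \<subseteq> K} = (\<lambda>x. t *\<^sub>R x) ` core"
    using scaled_core by (simp add: scale_set_def)
  have "smooth_set \<beta> ({c. cball c t \<subseteq> K} + cball 0 (1 / \<beta>))"
    unfolding eq using assms closed_core convex_core core_nonempty
    by (intro smooth_set_plus_cball closed_scaling convex_scaling) auto
  then show ?thesis
    using assms by (simp add: scaled_S_gen t_def)
qed

lemma s_gen_subset_S_gen:
  assumes "0 < r"
  shows "scale_set r (s_gen K) \<subseteq> scale_set r (S_gen K)"
proof -
  define t where "t = r * (1 - gap)"
  have "0 < t"
    using assms gap_less_1 by (simp add: t_def)
  have ball: "cball (t *\<^sub>R center) t \<subseteq> K"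
    using center_in_core cball_subset_scale_cone[OF cone \<open>0 < t\<close>] by (simp add: cone_core_eq)
  have "cball (t *\<^sub>R center + k) t \<subseteq> K" if "k \<in> K" for k
  proof
    fix y assume "y \<in> cball (t *\<^sub>R center + k) t"
    then have "y - k \<in> cball (t *\<^sub>R center) t"
      by (simp add: dist_norm algebra_simps)
    then show "y \<in> K"
      using ball convex_cone_add[OF cone _ that, of "y - k"] by auto
  qed
  then have "{t *\<^sub>R center} + K \<subseteq> {c. cball c t \<subseteq> K}"
    unfolding set_plus_def by blast
  then show ?thesis
    unfolding scaled_S_gen[OF assms] scaled_s_gen[OF assms] t_def
    by (rule set_plus_mono2) simp
qed

text \<open>
  A point of the maximal smoothing is pulled towards its ball center by the factor \<open>1 - gap\<close>, which
  moves it by at most \<open>gap * r\<close> and lands it in \<open>K\<close>. For a point \<open>k\<close> of \<open>K\<close>, the ball of radius \<open>r\<close> around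
  \<open>q + k\<close>, where \<open>q\<close> is the scaled center, lies in the minimal smoothing; as \<open>norm q\<close> is \<open>r + gap * r\<close>,
  the point of the segment from \<open>k\<close> to \<open>q + k\<close> at distance \<open>gap * r\<close> from \<open>k\<close> is in that ball.
\<close>

lemma between_gens_imp_close:
  assumes "0 < r" and sub: "scale_set r (s_gen K) \<subseteq> S" "S \<subseteq> scale_set r (S_gen K)"
  shows "hausdorff_dist S K \<le> ereal (gap * r)"
  unfolding hausdorff_dist_le_iff
proof (intro conjI ballI)
  fix x assume "x \<in> S"
  then have "x \<in> {c. cball c (r * (1 - gap)) \<subseteq> K} + cball 0 r"
    using sub(2) unfolding scaled_S_gen[OF \<open>0 < r\<close>] by blast
  then obtain c where c: "cball c (r * (1 - gap)) \<subseteq> K" "norm (x - c) \<le> r"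
    unfolding mem_plus_cball by blast
  define z where "z = c + (1 - gap) *\<^sub>R (x - c)"
  have "norm (z - c) \<le> r * (1 - gap)"
    using c(2) gap_less_1 by (simp add: z_def mult.commute)
  then have "z \<in> K"
    using c(1) by (auto simp: dist_norm norm_minus_commute)
  moreover have "x - z = gap *\<^sub>R (x - c)"
    by (simp add: z_def algebra_simps)
  then have "dist x z \<le> gap * r"
    using c(2) gap_nonneg by (simp add: dist_norm mult_left_mono)
  ultimately show "infdist x K \<le> gap * r"
    by (rule infdist_le2)
next
  fix k assume "k \<in> K"
  define q where "q = (r * (1 - gap)) *\<^sub>R center"
  define s where "s = k + gap *\<^sub>R (1 / (1 + gap)) *\<^sub>R q"
  have q: "norm q = r * (1 + gap)"
    using \<open>0 < r\<close> gap_less_1 gap_width by (simp add: q_def norm_center mult.assoc)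
  \<comment> \<open>Of the length \<open>r * (1 + gap)\<close> of \<open>q\<close>, the fraction \<open>gap / (1 + gap)\<close> is used up and \<open>r\<close> remains.\<close>
  have "s - (q + k) = - ((1 / (1 + gap)) *\<^sub>R q)"
  proof -
    have "gap / (1 + gap) - 1 = - (1 / (1 + gap))"
      using gap_nonneg by (simp add: field_simps)
    then have "(gap / (1 + gap)) *\<^sub>R q - 1 *\<^sub>R q = - ((1 / (1 + gap)) *\<^sub>R q)"
      by (metis scaleR_left_diff_distrib scaleR_minus_left)
    then show ?thesis
      by (simp add: s_def)
  qed
  then have "norm (s - (q + k)) \<le> r"
    using q gap_nonneg by simp
  moreover have "q + k \<in> {q} + K"
    using \<open>k \<in> K\<close> by (intro set_plus_intro) simp_all
  ultimately have "s \<in> scale_set r (s_gen K)"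
    unfolding scaled_s_gen[OF \<open>0 < r\<close>] mem_plus_cball q_def[symmetric] by blast
  then have "s \<in> S"
    using sub(1) by auto
  moreover have "dist k s \<le> gap * r"
    using q gap_nonneg by (simp add: s_def dist_norm)
  ultimately show "infdist k S \<le> gap * r"
    by (rule infdist_le2)
qed

context
  fixes \<beta> r e :: real and S :: "'a set"
  assumes \<beta>: "0 < \<beta>" and r: "r = 1 / \<beta>" and S: "smooth_set \<beta> S"
    and close: "hausdorff_dist S K \<le> ereal e"
begin

lemma radius_pos: "0 < r"
  using \<beta> r by simp

lemma inner_ball_in_cone:
  assumes "cball c r \<subseteq> S"
  shows "cball c (r - e) \<subseteq> K"
proof (rule cball_shrinks_into_convex[OF closed convex nonempty])
  show "0 \<le> e"
    using close S infdist_nonneg unfolding hausdorff_dist_le_iff smooth_set_def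
    by (metis all_not_in_conv order_trans)
qed (use assms close in \<open>auto simp: hausdorff_dist_le_iff\<close>)

lemma inner_ball_near_apex:
  obtains c where "cball c r \<subseteq> S" "norm c \<le> r + e"
proof -
  have "closed S" "S \<noteq> {}"
    using S by (auto simp: smooth_set_def)
  then obtain s where s: "s \<in> S" "infdist 0 S = dist 0 s"
    using infdist_attains_inf by metis
  then have "norm s \<le> e"
    using close convex_cone_contains_0[OF cone] by (auto simp: hausdorff_dist_le_iff)
  obtain c where c: "cball c r \<subseteq> S" "norm (s - c) \<le> r"
    using smooth_set_ball_cover[OF S \<beta> r s(1)] by metis
  have "norm c \<le> norm (s - c) + norm s"
    using norm_triangle_sub[of c s] by (simp add: norm_minus_commute)
  with c \<open>norm s \<le> e\<close> show thesis
    by (intro that[of c]) auto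
qed

text \<open>The two bounds \<open>(r - e) * (1 + w) \<le> norm c \<le> r + e\<close> on the same center \<open>c\<close> meet exactly at
  \<open>e = gap * r\<close>. For \<open>e \<ge> r\<close> the claim holds because \<open>gap < 1\<close>.\<close>

lemma gap_le_distance: "gap * r \<le> e"
proof (cases "e < r")
  case True
  obtain c where c: "cball c r \<subseteq> S" "norm c \<le> r + e"
    using inner_ball_near_apex .
  have "(r - e) * (1 + width) \<le> r + e"
    using inner_ball_norm_ge(1)[of "r - e" c] inner_ball_in_cone[OF c(1)] c(2) True by simp
  then show ?thesis
    using width_nonneg by (simp add: gap_def field_simps)
next
  case False
  have "gap * r \<le> 1 * r"
    using gap_less_1 radius_pos by (intro mult_right_mono) auto
  with False show ?thesis
    by simp
qed

lemma subset_S_gen: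
  assumes "e = gap * r"
  shows "S \<subseteq> scale_set r (S_gen K)"
proof
  fix s assume "s \<in> S"
  then obtain c where c: "cball c r \<subseteq> S" "norm (s - c) \<le> r"
    using smooth_set_ball_cover[OF S \<beta> r] by metis
  have "cball c (r * (1 - gap)) \<subseteq> K"
    using inner_ball_in_cone[OF c(1)] assms by (simp add: algebra_simps)
  with c(2) show "s \<in> scale_set r (S_gen K)"
    using radius_pos by (auto simp: scaled_S_gen mem_plus_cball)
qed

text \<open>At \<open>e = gap * r\<close> the ball center near the apex is within the minimal norm, so it is the scaled
  center of \<open>K\<close>; the translates of its ball along \<open>K\<close> stay in \<open>S\<close> by recession.\<close>

lemma s_gen_subset:
  assumes "e = gap * r"
  shows "scale_set r (s_gen K) \<subseteq> S"
proof
  define t where "t = r * (1 - gap)"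
  have t: "r - e = t" "0 < t"
    using gap_less_1 radius_pos assms by (simp_all add: t_def algebra_simps)
  have "t * (1 + width) = r * (1 + gap)"
    by (simp add: t_def mult.assoc gap_width)
  with assms have tw: "t * (1 + width) = r + e"
    by (simp add: algebra_simps)
  obtain c where c: "cball c r \<subseteq> S" "norm c \<le> r + e"
    using inner_ball_near_apex .
  then have center: "c = t *\<^sub>R center"
    using inner_ball_norm_ge(2)[of t c] inner_ball_in_cone[OF c(1)] t tw by simp
  fix y assume "y \<in> scale_set r (s_gen K)"
  then obtain z where "z \<in> {c} + K" "norm (y - z) \<le> r"
    unfolding scaled_s_gen[OF radius_pos] mem_plus_cball center t_def by blast
  then obtain k where k: "k \<in> K" "norm (y - (c + k)) \<le> r"
    by (auto elim: set_plus_elim)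
  then have "y - k \<in> cball c r"
    by (simp add: dist_norm norm_minus_commute algebra_simps)
  then have "y - k \<in> S"
    using c(1) by blast
  then have "(y - k) + k \<in> S"
    using S close k(1) by (intro nearby_cone_recession[OF _ _ cone])
      (auto simp: smooth_set_def hausdorff_dist_le_iff)
  then show "y \<in> S"
    by simp
qed

end

lemma smoothing_within_gap_iff:
  assumes "0 < \<beta>" "smooth_set \<beta> S"
  shows "hausdorff_dist S K \<le> ereal (gap / \<beta>) \<longleftrightarrow>
    scale_set (1 / \<beta>) (s_gen K) \<subseteq> S \<and> S \<subseteq> scale_set (1 / \<beta>) (S_gen K)"
proof
  assume "hausdorff_dist S K \<le> ereal (gap / \<beta>)"
  then show "scale_set (1 / \<beta>) (s_gen K) \<subseteq> S \<and> S \<subseteq> scale_set (1 / \<beta>) (S_gen K)"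
    using s_gen_subset[OF assms(1) refl assms(2)] subset_S_gen[OF assms(1) refl assms(2)] by simp
next
  assume "scale_set (1 / \<beta>) (s_gen K) \<subseteq> S \<and> S \<subseteq> scale_set (1 / \<beta>) (S_gen K)"
  then show "hausdorff_dist S K \<le> ereal (gap / \<beta>)"
    using between_gens_imp_close[of "1 / \<beta>" S] assms(1) by simp
qed

lemma S_gen_within_gap:
  "0 < \<beta> \<Longrightarrow> hausdorff_dist (scale_set (1 / \<beta>) (S_gen K)) K \<le> ereal (gap / \<beta>)"
  by (simp add: smoothing_within_gap_iff smooth_S_gen s_gen_subset_S_gen)

lemma optimal_smoothing_iff:
  assumes "0 < \<beta>" "smooth_set \<beta> S"
  shows "optimal_smoothing \<beta> K S \<longleftrightarrow> hausdorff_dist S K \<le> ereal (gap / \<beta>)"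
proof
  assume "optimal_smoothing \<beta> K S"
  then show "hausdorff_dist S K \<le> ereal (gap / \<beta>)"
    using smooth_S_gen S_gen_within_gap assms(1)
    by (metis hausdorff_dist_commute optimal_smoothing_def order_trans)
next
  assume S: "hausdorff_dist S K \<le> ereal (gap / \<beta>)"
  have "ereal (gap / \<beta>) \<le> hausdorff_dist T K" if "smooth_set \<beta> T" for T
    \<comment> \<open>The distance may be infinite, so the bound is tested on its real upper bounds.\<close>
    by (rule ereal_le_real) (use gap_le_distance[OF assms(1) refl that] in auto)
  with S assms(2) show "optimal_smoothing \<beta> K S"
    unfolding optimal_smoothing_def by (metis hausdorff_dist_commute order_trans)
qed

lemma smoothable_iff: "smoothable l K \<longleftrightarrow> gap \<le> l"
proof
  assume "smoothable l K"
  then obtain S where "smooth_set 1 S" "hausdorff_dist S K \<le> ereal l"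
    by (auto simp: smoothable_def dest!: spec[of _ 1])
  then show "gap \<le> l"
    using gap_le_distance[of 1 1 S l] by simp
next
  assume "gap \<le> l"
  then have "ereal (gap / \<beta>) \<le> ereal (l / \<beta>)" if "0 < \<beta>" for \<beta>
    using that by (simp add: divide_right_mono)
  then show "smoothable l K"
    unfolding smoothable_def using smooth_S_gen S_gen_within_gap order_trans by blast
qed

end

theorem theorem4p2:
  fixes K :: "'a::euclidean_space set"
  assumes "closed K"
    and "convex_cone K"
    and "interior K \<noteq> {}"
    and "K \<noteq> UNIV"
  shows "(\<forall>l::real. smoothable l K \<longleftrightarrow> l \<ge> cone_width K / (2 + cone_width K)) \<and>
    (\<forall>\<beta>>0. \<forall>S. smooth_set \<beta> S \<longrightarrow>
       (optimal_smoothing \<beta> K S \<longleftrightarrow>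
          scale_set (1 / \<beta>) (s_gen K) \<subseteq> S \<and> S \<subseteq> scale_set (1 / \<beta>) (S_gen K)))"
proof -
  interpret proper_solid_cone K
    using assms by unfold_locales
  show ?thesis
    using smoothable_iff optimal_smoothing_iff smoothing_within_gap_iff by (simp add: gap_def)
qed

end
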